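(* Let $t,a,b$ be reals such that $t\geq 1$, $0<a\leq e/(e+1)$ and $b>0$. Then $$h(t,a,b)>0.$$
   Context: For real $t>0$, $$h(t,a,b):=\frac{t^{a-1}}{e^t+1}-\frac{t^{a-1}e^{a\pi/b}}{e^{te^{\pi/b}}+1}.$$ Here $e$ is the base of the natural logarithm, so $e/(e+1)=0.731\cdots$. *)

theory Defs
  imports "HOL-Analysis.Analysis"
begin

definition h :: "real \<Rightarrow> real \<Rightarrow> real \<Rightarrow> real" where
  "h t a b =
     t powr (a - 1) / (exp t + 1)
     - t powr (a - 1) * exp (a * pi / b) / (exp (t * exp (pi / b)) + 1)"

end

theory Submission
  imports Defs
begin

text \<open>
  Put \<open>x = pi / b\<close> and \<open>c = exp x > 1\<close>. After the positive factor \<open>t powr (a - 1)\<close> is cancelled,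
  the claim says \<open>c\<^sup>a * (exp t + 1) < exp (t * c) + 1\<close>. Both sides agree at \<open>c = 1\<close>, and
  linear bounds in \<open>c - 1\<close> separate them: \<open>c\<^sup>a\<close> is concave in \<open>c\<close> because \<open>0 < a < 1\<close>, hence lies below its tangent
  \<open>1 + a * (c - 1)\<close>, while \<open>exp (t * c) = exp t * exp (t * (c - 1))\<close> lies strictly above its
  tangent \<open>exp t * (1 + t * (c - 1))\<close>. The slopes compare as
  \<open>a * (exp t + 1) \<le> exp t \<le> t * exp t\<close>: since \<open>exp t / (exp t + 1)\<close> increases with \<open>t\<close>,
  the bound on \<open>a\<close> is exactly what the first comparison requires at \<open>t = 1\<close>.
\<close>

text \<open>
  Bernoulli's inequality for a power of \<open>exp x\<close> with exponent in \<open>[0, 1]\<close>; it is the convexity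
  of the exponential function between \<open>0\<close> and \<open>x\<close>.
\<close>
lemma exp_mult_le_tangent:
  fixes a x :: real
  assumes "0 \<le> a" and "a \<le> 1"
  shows "exp (a * x) \<le> 1 + a * (exp x - 1)"
  using convex_onD[OF exp_convex, of a 0 x] assms by (simp add: algebra_simps)

text \<open>
  The comparison of slopes: the logistic function \<open>exp t / (exp t + 1)\<close> is increasing, so its
  value at \<open>1\<close> is the largest \<open>a\<close> for which the inequality holds at every \<open>t \<ge> 1\<close>.
\<close>
lemma mult_exp_add_one_le_exp:
  fixes a t :: real
  assumes "1 \<le> t" and "a \<le> exp 1 / (exp 1 + 1)"
  shows "a * (exp t + 1) \<le> exp t"
proof -
  have "exp 1 / (exp 1 + 1) \<le> exp t / (exp t + 1)"
    using assms(1) by (simp add: divide_simps add_pos_pos algebra_simps)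
  then have "a \<le> exp t / (exp t + 1)"
    using assms(2) by linarith
  then show ?thesis
    by (simp add: pos_le_divide_eq add_pos_pos)
qed

lemma exp_mult_less_exp_mult_exp:
  fixes t a x :: real
  assumes "1 \<le> t" and "0 < a" and "a \<le> exp 1 / (exp 1 + 1)" and "0 < x"
  shows "exp (a * x) * (exp t + 1) < exp (t * exp x) + 1"
proof -
  define d where "d = exp x - 1"
  have d: "0 < d"
    using \<open>0 < x\<close> by (simp add: d_def)
  have "exp 1 / (exp 1 + 1) \<le> (1::real)"
    by (simp add: divide_simps add_pos_pos)
  then have "exp (a * x) \<le> 1 + a * d"
    using assms exp_mult_le_tangent[of a x] by (simp add: d_def)
  then have "exp (a * x) * (exp t + 1) \<le> (1 + a * d) * (exp t + 1)"
    by (intro mult_right_mono) (auto intro: add_nonneg_nonneg)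
  also have "\<dots> = exp t + 1 + a * (exp t + 1) * d"
    by (simp add: algebra_simps)
  also have "\<dots> \<le> exp t + 1 + exp t * d"
    using mult_exp_add_one_le_exp[OF assms(1,3)] d by (simp add: mult_right_mono)
  also have "\<dots> \<le> exp t * (1 + t * d) + 1"
    using assms(1) d by (simp add: algebra_simps)
  also have "\<dots> < exp t * exp (t * d) + 1"
    using exp_minus_greater[of "- (t * d)"] assms(1) d by simp
  also have "exp t * exp (t * d) = exp (t * exp x)"
    by (simp add: d_def algebra_simps flip: exp_add)
  finally show ?thesis .
qed

theorem theorem10:
  fixes t a b :: real
  assumes "t \<ge> 1" and "0 < a" and "a \<le> exp 1 / (exp 1 + 1)" and "b > 0"
  shows "h t a b > 0"
proof -
  have pos: "0 < exp t + 1" "0 < exp (t * exp (pi / b)) + 1"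
    by (simp_all add: add_pos_pos)
  have "exp (a * pi / b) * (exp t + 1) < exp (t * exp (pi / b)) + 1"
    using exp_mult_less_exp_mult_exp[of t a "pi / b"] assms by simp
  then have "exp (a * pi / b) / (exp (t * exp (pi / b)) + 1) < 1 / (exp t + 1)"
    using pos by (simp add: field_simps)
  moreover have "0 < t powr (a - 1)"
    using assms(1) by simp
  ultimately have "t powr (a - 1) * (exp (a * pi / b) / (exp (t * exp (pi / b)) + 1))
      < t powr (a - 1) * (1 / (exp t + 1))"
    by (rule mult_strict_left_mono)
  then show ?thesis
    by (simp add: h_def)
qed

end
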